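(* Let $\lambda>0$, $T>0$ and $p=1-e^{-\lambda T}$. Then the sequence of edge distances $$\delta(n)=\frac{p}{\lambda(1-p)}\,\frac{\ln(n)}{n}$$ is a strong (and weak) threshold for connectivity for the graph $G_n(\lambda,\cdot,T)$.
   Context: $G_n(\lambda,r,T)$ is the graph whose vertices are $n$ i.i.d. random points with density $g_{\lambda,T}(x)=\lambda e^{-\lambda x}/(1-e^{-\lambda T})$, $0\le x\le T$, with an edge between two distinct vertices if and only if their distance is at most the cutoff $r$. For functions $\delta,\gamma:\mathbb{Z}^+\to\mathbb{R}^+$ write $\delta\ll\gamma$ if $\delta(n)/\gamma(n)\to 0$, and $\delta\gg\gamma$ if $\gamma(n)/\delta(n)\to0$, as $n\to\infty$. For a property $\Theta$ (here: being connected) and a random geometric graph $G_n(r)$ on $n$ vertices with cutoff $r$ (here $G_n(\lambda,r,T)$), a function $\delta_\Theta:\mathbb{Z}^+\to\mathbb{R}^+$ is a weak threshold function for $\Theta$ if for every $\delta:\mathbb{Z}^+\to\mathbb{R}^+$: $\delta\ll\delta_\Theta$ implies $\Pr(G_n(\delta(n))\in\Theta)=o(1)$, and $\delta\gg\delta_\Theta$ implies $\Pr(G_n(\delta(n))\in\Theta)=1-o(1)$. It is a strong threshold function for $\Theta$ if for every fixed $\epsilon>0$ (with $\epsilon<1$ in the first condition): $\Pr(G_n((1-\epsilon)\delta_\Theta(n))\in\Theta)=o(1)$ and $\Pr(G_n((1+\epsilon)\delta_\Theta(n))\in\Theta)=1-o(1)$. *)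

theory Defs
  imports "HOL-Probability.Probability" "Graph_Theory.Graph_Theory"
begin

definition trunc_exp_density :: "real \<Rightarrow> real \<Rightarrow> real \<Rightarrow> real" where
  "trunc_exp_density rate T x =
     (if 0 \<le> x \<and> x \<le> T then rate * exp (- rate * x) / (1 - exp (- rate * T)) else 0)"

definition trunc_exp :: "real \<Rightarrow> real \<Rightarrow> real measure" where
  "trunc_exp rate T = density lborel (\<lambda>x. ennreal (trunc_exp_density rate T x))"

(* Vertex i stands for the point x i.  An undirected edge is represented by its two arcs (i, j)
   and (j, i), so the result is a finite simple graph; see geometric_graph_is_graph. *)
definition geometric_graph :: "nat \<Rightarrow> real \<Rightarrow> (nat \<Rightarrow> real) \<Rightarrow> nat pair_pre_digraph" where
  "geometric_graph n r x =
     \<lparr> pverts = {..<n},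
       parcs = {(i, j). i < n \<and> j < n \<and> i \<noteq> j \<and> dist (x i) (x j) \<le> r} \<rparr>"

lemma geometric_graph_is_graph: "pair_graph (geometric_graph n r x)"
proof -
  have "finite {(i, j). i < n \<and> j < n \<and> i \<noteq> j \<and> dist (x i) (x j) \<le> r}"
    by (rule finite_subset[of _ "{..<n} \<times> {..<n}"]) auto
  then show ?thesis
    by unfold_locales
      (auto simp: geometric_graph_def symmetric_def sym_def dist_commute)
qed

definition random_points :: "real measure \<Rightarrow> nat \<Rightarrow> (nat \<Rightarrow> real) measure" where
  "random_points \<mu> n = PiM {..<n} (\<lambda>_. \<mu>)"

definition rgg_prob ::
    "real measure \<Rightarrow> (nat pair_pre_digraph \<Rightarrow> bool) \<Rightarrow> nat \<Rightarrow> real \<Rightarrow> real" where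
  "rgg_prob \<mu> \<Theta> n r =
     measure (random_points \<mu> n)
       {x \<in> space (random_points \<mu> n). \<Theta> (geometric_graph n r x)}"

definition much_less :: "(nat \<Rightarrow> real) \<Rightarrow> (nat \<Rightarrow> real) \<Rightarrow> bool" (infix "\<lless>" 50) where
  "\<delta> \<lless> \<gamma> \<longleftrightarrow> (\<lambda>n. \<delta> n / \<gamma> n) \<longlonglongrightarrow> 0"

(* Cutoff functions are only required to be positive for all large n, because ln n / n vanishes
   at n = 1.  Some positivity is indispensable: division by zero yields zero, so the zero function
   would otherwise be both much smaller and much larger than every function. *)
definition cutoff_fun :: "(nat \<Rightarrow> real) \<Rightarrow> bool" where
  "cutoff_fun \<delta> \<longleftrightarrow> (\<forall>\<^sub>F n in sequentially. 0 < \<delta> n)"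

definition weak_threshold ::
    "real measure \<Rightarrow> (nat pair_pre_digraph \<Rightarrow> bool) \<Rightarrow> (nat \<Rightarrow> real) \<Rightarrow> bool" where
  "weak_threshold \<mu> \<Theta> \<delta>\<^sub>\<Theta> \<longleftrightarrow>
     cutoff_fun \<delta>\<^sub>\<Theta> \<and>
     (\<forall>\<delta>. cutoff_fun \<delta> \<longrightarrow>
        (\<delta> \<lless> \<delta>\<^sub>\<Theta> \<longrightarrow> (\<lambda>n. rgg_prob \<mu> \<Theta> n (\<delta> n)) \<longlonglongrightarrow> 0) \<and>
        (\<delta>\<^sub>\<Theta> \<lless> \<delta> \<longrightarrow> (\<lambda>n. rgg_prob \<mu> \<Theta> n (\<delta> n)) \<longlonglongrightarrow> 1))"

definition strong_threshold ::
    "real measure \<Rightarrow> (nat pair_pre_digraph \<Rightarrow> bool) \<Rightarrow> (nat \<Rightarrow> real) \<Rightarrow> bool" where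
  "strong_threshold \<mu> \<Theta> \<delta>\<^sub>\<Theta> \<longleftrightarrow>
     cutoff_fun \<delta>\<^sub>\<Theta> \<and>
     (\<forall>\<epsilon>>0.
        (\<epsilon> < 1 \<longrightarrow> (\<lambda>n. rgg_prob \<mu> \<Theta> n ((1 - \<epsilon>) * \<delta>\<^sub>\<Theta> n)) \<longlonglongrightarrow> 0) \<and>
        (\<lambda>n. rgg_prob \<mu> \<Theta> n ((1 + \<epsilon>) * \<delta>\<^sub>\<Theta> n)) \<longlonglongrightarrow> 1)"

definition connected_graph :: "nat pair_pre_digraph \<Rightarrow> bool" where
  "connected_graph G \<longleftrightarrow> Digraph_Component.connected (with_proj G)"

(* The definitions of random_points and rgg_prob are meaningful for the measure trunc_exp: it is
   a probability measure, and every graph property is an event. *)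

lemma prob_space_trunc_exp:
  assumes "rate > 0" "T > 0"
  shows "prob_space (trunc_exp rate T)"
proof
  let ?p = "1 - exp (- rate * T)"
  have p: "?p > 0" using assms by simp
  have "emeasure (trunc_exp rate T) (space (trunc_exp rate T)) =
      (\<integral>\<^sup>+x. ennreal (rate * exp (- rate * x) / ?p) * indicator {0..T} x \<partial>lborel)"
    unfolding trunc_exp_def
    by (subst emeasure_density)
      (auto simp: trunc_exp_density_def indicator_def intro!: nn_integral_cong)
  also have "\<dots> = ennreal (- exp (- rate * T) / ?p - (- exp (- rate * 0) / ?p))"
    using assms p
    by (intro nn_integral_FTC_Icc) (auto intro!: derivative_eq_intros)
  also have "- exp (- rate * T) / ?p - (- exp (- rate * 0) / ?p) = 1"
    using assms by (simp add: diff_divide_distrib[symmetric])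
  finally show "emeasure (trunc_exp rate T) (space (trunc_exp rate T)) = 1" by simp
qed

lemma geometric_graph_event:
  assumes [measurable_cong]: "sets \<mu> = sets borel"
  shows "{x \<in> space (random_points \<mu> n). \<Theta> (geometric_graph n r x)} \<in> sets (random_points \<mu> n)"
proof -
  let ?M = "random_points \<mu> n"
  let ?F = "{E \<in> Pow ({..<n} \<times> {..<n}). \<Theta> \<lparr> pverts = {..<n}, parcs = E \<rparr>}"
  have "{x \<in> space ?M. parcs (geometric_graph n r x) = E} \<in> sets ?M"
    if "E \<subseteq> {..<n} \<times> {..<n}" for E
  proof -
    have "{x \<in> space ?M. parcs (geometric_graph n r x) = E} =
        {x \<in> space ?M. \<forall>i\<in>{..<n}. \<forall>j\<in>{..<n}. (i \<noteq> j \<and> dist (x i) (x j) \<le> r) = ((i, j) \<in> E)}"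
      using that by (fastforce simp: geometric_graph_def)
    also have "\<dots> \<in> sets ?M"
      unfolding random_points_def by measurable
    finally show ?thesis .
  qed
  then have "(\<Union>E\<in>?F. {x \<in> space ?M. parcs (geometric_graph n r x) = E}) \<in> sets ?M"
    by (intro sets.finite_UN) auto
  also have "(\<Union>E\<in>?F. {x \<in> space ?M. parcs (geometric_graph n r x) = E}) =
      {x \<in> space ?M. \<Theta> (geometric_graph n r x)}"
    by (auto simp: geometric_graph_def)
  finally show ?thesis .
qed

end

theory Submission
  imports Defs "HOL-Real_Asymp.Real_Asymp"
begin

text \<open>
  Points on the line span a connected geometric graph exactly when no two consecutive points are
  further than the cutoff apart, so the question is how long the longest gap is.  A fixed interval
  of length \<open>r\<close> on which the density is about \<open>g\<close> misses all \<open>n\<close> points with probability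
  about \<open>exp (- n g r)\<close>, and there are about \<open>1 / r\<close> disjoint places for it, which is \<open>n\<close> up to a
  logarithm.  Gaps of length \<open>r\<close> therefore occur or disappear according to whether
  \<open>n g r\<close> is below or above \<open>ln n\<close>, and they survive longest where the density is least.  Its
  minimum \<open>m\<close>, which for the truncated exponential distribution is \<open>rate (1 - p) / p\<close> and is
  attained at \<open>T\<close>, gives the threshold \<open>ln n / (m n)\<close>.

  Above the threshold, every gap longer than \<open>w + h\<close> contains one of the windows
  \<open>(a + k h, a + k h + w]\<close>.  With \<open>w\<close> the threshold itself and \<open>h = \<epsilon> w\<close>, each window is
  empty with probability at most about \<open>1 / n\<close>, while there are only \<open>O (n / ln n)\<close> windows, so the
  union bound suffices (\<open>prob_disconnected_le\<close>).

  Below the threshold, a region where the density is close to \<open>m\<close> is cut into disjoint intervals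
  of length \<open>r\<close>.  The expected number of empty ones tends to infinity, and their
  emptiness events are negatively correlated, so Chebyshev's inequality makes an empty one likely
  (\<open>prob_no_event_le_inverse_sum\<close>).  It disconnects the graph unless all points lie on
  one side of it, which is excluded by a point in each of two fixed intervals of positive measure
  to the left and to the right of the region (\<open>prob_connected_le\<close>).

  The weak threshold follows from the strong one because connectivity is monotone in the cutoff.
\<close>

section \<open>Connectivity of geometric graphs on the line\<close>

lemma connected_graph_iff_reachable:
  "connected_graph G \<longleftrightarrow>
     pverts G \<noteq> {} \<and>
     (\<forall>u\<in>pverts G. \<forall>v\<in>pverts G. u \<rightarrow>\<^sup>*\<^bsub>with_proj (mk_symmetric (with_proj G))\<^esub> v)"
  by (simp add: connected_graph_def Digraph_Component.connected_def strongly_connected_def)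

lemma connected_geometric_graph_iff:
  "connected_graph (geometric_graph n r x) \<longleftrightarrow>
     0 < n \<and> (\<forall>u<n. \<forall>v<n. u \<rightarrow>\<^sup>*\<^bsub>with_proj (geometric_graph n r x)\<^esub> v)"
proof -
  interpret pair_graph "geometric_graph n r x" by (rule geometric_graph_is_graph)
  have "symmetric (with_proj (geometric_graph n r x))" by (rule sym_arcs)
  then show ?thesis
    unfolding connected_graph_iff_reachable
    by (simp add: reachable_mk_symmetric_eq) (auto simp: geometric_graph_def)
qed

text \<open>A path starting at or below \<open>s\<close> cannot jump over the empty interval \<open>(s, s + r]\<close>.\<close>

lemma connected_geometric_graph_not_split:
  assumes conn: "connected_graph (geometric_graph n r x)"
    and cut: "\<And>k. k < n \<Longrightarrow> x k \<le> s \<or> s + r < x k"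
    and u: "u < n" "x u \<le> s"
    and v: "v < n"
  shows "x v \<le> s"
proof -
  have "u \<rightarrow>\<^sup>*\<^bsub>with_proj (geometric_graph n r x)\<^esub> v"
    using conn u v by (simp add: connected_geometric_graph_iff)
  then show ?thesis
    unfolding reachable_def
  proof (induction rule: rtrancl_on_induct)
    case base
    show ?case by (rule u)
  next
    case (step y z)
    then have "z < n" "dist (x y) (x z) \<le> r"
      by (auto simp: geometric_graph_def)
    with step.IH cut[of z] show ?case
      by (auto simp: dist_real_def)
  qed
qed

text \<open>Without a gap the leftmost vertex reaches every vertex \<open>j\<close>, by induction on the number of
  points to the left of \<open>j\<close>: the rightmost of these is adjacent to \<open>j\<close>.\<close>

lemma not_connected_obtains_gap:
  assumes n: "0 < n" and r: "0 \<le> r"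
    and nc: "\<not> connected_graph (geometric_graph n r x)"
  obtains i j where "i < n" "j < n" "x i + r < x j"
    "\<And>k. k < n \<Longrightarrow> x k \<le> x i \<or> x j \<le> x k"
proof (rule ccontr)
  assume "\<not> thesis"
  with that have nogap:
    "\<exists>k<n. x i < x k \<and> x k < x j" if "i < n" "j < n" "x i + r < x j" for i j
    using \<open>i < n\<close> \<open>j < n\<close> \<open>x i + r < x j\<close> by (meson not_le)
  let ?G = "with_proj (geometric_graph n r x)"
  interpret pair_graph "geometric_graph n r x" by (rule geometric_graph_is_graph)
  have adj: "u \<rightarrow>\<^sup>*\<^bsub>?G\<^esub> v" if "u < n" "v < n" "\<bar>x u - x v\<bar> \<le> r" for u v
  proof (cases "u = v")
    case True
    with that show ?thesis by (auto simp: reachable_def geometric_graph_def)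
  next
    case False
    with that have "(u, v) \<in> parcs (geometric_graph n r x)"
      by (auto simp: geometric_graph_def dist_real_def)
    then show ?thesis by (rule reachable_adjI)
  qed
  have "Min (x ` {..<n}) \<in> x ` {..<n}" using n by (intro Min_in) auto
  then obtain l where l: "l < n" "x l = Min (x ` {..<n})" by auto
  have l_min: "x l \<le> x k" if "k < n" for k
    unfolding l(2) using that by (intro Min_le) auto
  have reach: "l \<rightarrow>\<^sup>*\<^bsub>?G\<^esub> j" if "j < n" for j
    using that
  proof (induction "card {k. k < n \<and> x k < x j}" arbitrary: j rule: less_induct)
    case less
    show ?case
    proof (cases "x j = x l")
      case True
      with l(1) less.prems r show ?thesis by (intro adj) auto
    next
      case False
      let ?B = "{k. k < n \<and> x k < x j}"
      have "l \<in> ?B" using l(1) l_min[OF less.prems] False by (simp add: order_less_le)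
      then have "Max (x ` ?B) \<in> x ` ?B" by (intro Max_in) auto
      then obtain i where i: "i \<in> ?B" "x i = Max (x ` ?B)" by auto
      have i_max: "x k \<le> x i" if "k \<in> ?B" for k
        unfolding i(2) using that by (intro Max_ge) auto
      have "{k. k < n \<and> x k < x i} \<subset> ?B" using i(1) by auto
      then have "card {k. k < n \<and> x k < x i} < card ?B"
        by (intro psubset_card_mono) auto
      with less.hyps i(1) have li: "l \<rightarrow>\<^sup>*\<^bsub>?G\<^esub> i" by auto
      have "x j \<le> x i + r"
      proof (rule ccontr)
        assume "\<not> x j \<le> x i + r"
        then obtain k where "k < n" "x i < x k" "x k < x j"
          using nogap[of i j] i(1) less.prems by auto
        with i_max[of k] show False by simp
      qed
      with i(1) less.prems have "i \<rightarrow>\<^sup>*\<^bsub>?G\<^esub> j" by (intro adj) auto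
      with li show ?thesis by (rule reachable_trans)
    qed
  qed
  have "connected_graph (geometric_graph n r x)"
    unfolding connected_geometric_graph_iff
  proof (intro conjI allI impI n)
    fix u v assume "u < n" "v < n"
    have "u \<rightarrow>\<^sup>*\<^bsub>?G\<^esub> l"
      using reach[OF \<open>u < n\<close>] symmetric_reachable[OF sym_arcs] by blast
    then show "u \<rightarrow>\<^sup>*\<^bsub>?G\<^esub> v"
      using reach[OF \<open>v < n\<close>] by (rule reachable_trans)
  qed
  with nc show False by simp
qed

text \<open>A gap of length more than \<open>r'\<close> is also one of length more than \<open>r\<close>.\<close>

lemma connected_geometric_graph_mono:
  assumes conn: "connected_graph (geometric_graph n r x)" and r: "0 \<le> r" "r \<le> r'"
  shows "connected_graph (geometric_graph n r' x)"
proof (rule ccontr)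
  have n: "0 < n" using conn by (simp add: connected_geometric_graph_iff)
  have r': "0 \<le> r'" using r by simp
  assume "\<not> connected_graph (geometric_graph n r' x)"
  from not_connected_obtains_gap[OF n r' this]
  obtain i j where ij: "i < n" "j < n" "x i + r' < x j"
    and gap: "\<And>k. k < n \<Longrightarrow> x k \<le> x i \<or> x j \<le> x k" by blast
  have "x j \<le> x i"
  proof (rule connected_geometric_graph_not_split[OF conn])
    fix k assume "k < n"
    then show "x k \<le> x i \<or> x i + r < x k" using gap[of k] ij r by linarith
  qed (use ij in auto)
  with ij r show False by linarith
qed

section \<open>Probability tools\<close>

text \<open>The second moment method.  The number of events that occur has mean \<open>S\<close> and, because
  off-diagonal covariances are at most zero, variance at most \<open>S\<close>; by Chebyshev's inequality it
  deviates from its mean by \<open>S\<close> with probability at most \<open>S / S\<^sup>2\<close>.\<close>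

lemma (in prob_space) prob_no_event_le_inverse_sum:
  assumes K: "finite K" and ev: "\<And>k. k \<in> K \<Longrightarrow> A k \<in> events"
    and neg: "\<And>k l. k \<in> K \<Longrightarrow> l \<in> K \<Longrightarrow> k \<noteq> l \<Longrightarrow> prob (A k \<inter> A l) \<le> prob (A k) * prob (A l)"
    and pos: "0 < (\<Sum>k\<in>K. prob (A k))"
  shows "prob {x \<in> space M. \<forall>k\<in>K. x \<notin> A k} \<le> 1 / (\<Sum>k\<in>K. prob (A k))"
proof -
  define S where "S = (\<Sum>k\<in>K. prob (A k))"
  define f :: "'a \<Rightarrow> real" where "f = (\<lambda>x. \<Sum>k\<in>K. indicator (A k) x)"
  have sq: "(\<lambda>x. (f x)\<^sup>2) = (\<lambda>x. \<Sum>k\<in>K. \<Sum>l\<in>K. indicator (A k \<inter> A l) x)"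
    unfolding f_def power2_eq_square sum_product by (simp only: indicator_inter_arith)
  have int: "integrable M f"
    unfolding f_def using ev
    by (intro Bochner_Integration.integrable_sum integrable_real_indicator) (auto simp: emeasure_eq_measure)
  have int2: "integrable M (\<lambda>x. (f x)\<^sup>2)"
    unfolding sq using ev
    by (intro Bochner_Integration.integrable_sum integrable_real_indicator) (auto simp: emeasure_eq_measure)
  have Ef: "expectation f = S"
    unfolding f_def S_def using ev
    by (subst Bochner_Integration.integral_sum)
       (auto intro!: integrable_real_indicator sum.cong simp: emeasure_eq_measure)
  have "expectation (\<lambda>x. (f x)\<^sup>2) = (\<Sum>k\<in>K. \<Sum>l\<in>K. prob (A k \<inter> A l))"
    unfolding sq using ev
    by (subst Bochner_Integration.integral_sum,
        (intro Bochner_Integration.integrable_sum integrable_real_indicator; auto simp: emeasure_eq_measure),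
        intro sum.cong refl, subst Bochner_Integration.integral_sum)
       (auto intro!: integrable_real_indicator sum.cong simp: emeasure_eq_measure)
  also have "\<dots> \<le> (\<Sum>k\<in>K. \<Sum>l\<in>K. (if l = k then prob (A k) else 0) + prob (A k) * prob (A l))"
    using neg by (intro sum_mono) auto
  also have "\<dots> = S + S\<^sup>2"
    using K by (simp add: sum.distrib S_def power2_eq_square sum_product)
  finally have var: "variance f \<le> S"
    using variance_eq[OF int int2] Ef by simp
  have meas: "f \<in> borel_measurable M" using int by (rule borel_measurable_integrable)
  have "prob {x \<in> space M. \<forall>k\<in>K. x \<notin> A k} \<le> prob {x \<in> space M. \<bar>f x - expectation f\<bar> \<ge> S}"
  proof (rule finite_measure_mono)
    show "{x \<in> space M. \<bar>f x - expectation f\<bar> \<ge> S} \<in> events"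
      using meas by measurable
    show "{x \<in> space M. \<forall>k\<in>K. x \<notin> A k} \<subseteq> {x \<in> space M. \<bar>f x - expectation f\<bar> \<ge> S}"
      unfolding Ef using pos by (auto simp: f_def S_def)
  qed
  also have "\<dots> \<le> variance f / S\<^sup>2"
    using Chebyshev_inequality[OF meas int2] pos by (simp add: S_def)
  also have "\<dots> \<le> S / S\<^sup>2"
    using var by (intro divide_right_mono) auto
  also have "\<dots> = 1 / S" using pos by (simp add: S_def power2_eq_square)
  finally show ?thesis by (simp add: S_def)
qed

lemma prob_space_random_points:
  "prob_space \<mu> \<Longrightarrow> prob_space (random_points \<mu> n)"
  unfolding random_points_def by (intro prob_space_PiM)

lemma random_points_all_in_eq:
  assumes "B \<subseteq> space \<mu>"
  shows "{x \<in> space (random_points \<mu> n). \<forall>j<n. x j \<in> B} = (\<Pi>\<^sub>E j\<in>{..<n}. B)"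
  using assms
  unfolding random_points_def space_PiM set_eq_iff mem_Collect_eq PiE_iff Ball_def lessThan_iff
  by blast

lemma random_points_all_in_event:
  assumes "B \<in> sets \<mu>"
  shows "{x \<in> space (random_points \<mu> n). \<forall>j<n. x j \<in> B} \<in> sets (random_points \<mu> n)"
proof -
  have "(\<Pi>\<^sub>E j\<in>{..<n}. B) \<in> sets (random_points \<mu> n)"
    unfolding random_points_def using assms by (intro sets_PiM_I_finite) auto
  then show ?thesis
    by (simp only: random_points_all_in_eq[OF sets.sets_into_space[OF assms]])
qed

lemma prob_random_points_all_in:
  assumes "prob_space \<mu>" and B: "B \<in> sets \<mu>"
  shows "measure (random_points \<mu> n) {x \<in> space (random_points \<mu> n). \<forall>j<n. x j \<in> B} =
    measure \<mu> B ^ n"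
proof -
  interpret prob_space \<mu> by fact
  interpret P: finite_product_prob_space "\<lambda>_. \<mu>" "{..<n}"
    by unfold_locales auto
  show ?thesis
    unfolding random_points_all_in_eq[OF sets.sets_into_space[OF B]]
    using P.prob_times[of "\<lambda>_. B"] B by (simp add: random_points_def)
qed

definition avoiding :: "real measure \<Rightarrow> nat \<Rightarrow> real set \<Rightarrow> (nat \<Rightarrow> real) set" where
  "avoiding \<mu> n I = {x \<in> space (random_points \<mu> n). \<forall>j<n. x j \<notin> I}"

lemma
  assumes "prob_space \<mu>" and \<mu>: "sets \<mu> = sets borel" and I: "I \<in> sets borel"
  shows avoiding_event: "avoiding \<mu> n I \<in> sets (random_points \<mu> n)"
    and prob_avoiding: "measure (random_points \<mu> n) (avoiding \<mu> n I) = (1 - measure \<mu> I) ^ n"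
proof -
  interpret prob_space \<mu> by fact
  have sp: "space \<mu> = UNIV" using sets_eq_imp_space_eq[OF \<mu>] by simp
  have I': "- I \<in> sets \<mu>" "I \<in> sets \<mu>" using I \<mu> by auto
  have eq: "avoiding \<mu> n I = {x \<in> space (random_points \<mu> n). \<forall>j<n. x j \<in> - I}"
    by (simp add: avoiding_def)
  show "avoiding \<mu> n I \<in> sets (random_points \<mu> n)"
    unfolding eq by (rule random_points_all_in_event[OF I'(1)])
  have "measure \<mu> (- I) = 1 - measure \<mu> I"
    using prob_compl[OF I'(2)] sp by (simp add: Compl_eq_Diff_UNIV)
  then show "measure (random_points \<mu> n) (avoiding \<mu> n I) = (1 - measure \<mu> I) ^ n"
    unfolding eq using prob_random_points_all_in[OF \<open>prob_space \<mu>\<close> I'(1)] by simp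
qed

text \<open>For a monotone property it suffices to compare the cutoff with \<open>\<delta> / 2\<close> and with
  \<open>2 \<delta>\<close>, that is, to use the strong threshold for \<open>\<epsilon> = 1 / 2\<close> and \<open>\<epsilon> = 1\<close>.\<close>

lemma strong_threshold_imp_weak_threshold:
  assumes "prob_space \<mu>"
    and mono: "\<And>n r r'. 0 \<le> r \<Longrightarrow> r \<le> r' \<Longrightarrow> rgg_prob \<mu> \<Theta> n r \<le> rgg_prob \<mu> \<Theta> n r'"
    and strong: "strong_threshold \<mu> \<Theta> \<delta>"
  shows "weak_threshold \<mu> \<Theta> \<delta>"
proof -
  have pos: "\<forall>\<^sub>F n in sequentially. 0 < \<delta> n"
    and lower: "(\<lambda>n. rgg_prob \<mu> \<Theta> n (1 / 2 * \<delta> n)) \<longlonglongrightarrow> 0"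
    and upper: "(\<lambda>n. rgg_prob \<mu> \<Theta> n (2 * \<delta> n)) \<longlonglongrightarrow> 1"
    using strong unfolding strong_threshold_def cutoff_fun_def
    by (auto dest: spec[of _ "1/2::real"] spec[of _ "1::real"])
  have le1: "rgg_prob \<mu> \<Theta> n r \<le> 1" and ge0: "0 \<le> rgg_prob \<mu> \<Theta> n r" for n r
    using prob_space.prob_le_1[OF prob_space_random_points[OF \<open>prob_space \<mu>\<close>]]
    by (auto simp: rgg_prob_def)
  have "(\<lambda>n. rgg_prob \<mu> \<Theta> n (\<gamma> n)) \<longlonglongrightarrow> 0"
    if \<gamma>: "\<forall>\<^sub>F n in sequentially. 0 < \<gamma> n" and lim: "(\<lambda>n. \<gamma> n / \<delta> n) \<longlonglongrightarrow> 0" for \<gamma>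
  proof (rule tendsto_sandwich[OF _ _ tendsto_const lower])
    have "\<forall>\<^sub>F n in sequentially. \<gamma> n / \<delta> n < 1 / 2"
      by (rule order_tendstoD(2)[OF lim]) simp
    with \<gamma> pos show "\<forall>\<^sub>F n in sequentially. rgg_prob \<mu> \<Theta> n (\<gamma> n) \<le> rgg_prob \<mu> \<Theta> n (1 / 2 * \<delta> n)"
      by eventually_elim (intro mono, auto simp: field_simps)
  qed (simp add: ge0)
  moreover have "(\<lambda>n. rgg_prob \<mu> \<Theta> n (\<gamma> n)) \<longlonglongrightarrow> 1"
    if \<gamma>: "\<forall>\<^sub>F n in sequentially. 0 < \<gamma> n" and lim: "(\<lambda>n. \<delta> n / \<gamma> n) \<longlonglongrightarrow> 0" for \<gamma>
  proof (rule tendsto_sandwich[OF _ _ upper tendsto_const])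
    have "\<forall>\<^sub>F n in sequentially. \<delta> n / \<gamma> n < 1 / 2"
      by (rule order_tendstoD(2)[OF lim]) simp
    with \<gamma> pos show "\<forall>\<^sub>F n in sequentially. rgg_prob \<mu> \<Theta> n (2 * \<delta> n) \<le> rgg_prob \<mu> \<Theta> n (\<gamma> n)"
      by eventually_elim (intro mono, auto simp: field_simps)
  qed (simp add: le1)
  ultimately show ?thesis
    using pos unfolding weak_threshold_def much_less_def cutoff_fun_def by blast
qed

lemma rgg_prob_connected_mono:
  assumes "prob_space \<mu>" and \<mu>: "sets \<mu> = sets borel" and r: "0 \<le> r" "r \<le> r'"
  shows "rgg_prob \<mu> connected_graph n r \<le> rgg_prob \<mu> connected_graph n r'"
proof -
  interpret P: prob_space "random_points \<mu> n"
    by (intro prob_space_random_points assms)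
  show ?thesis
    unfolding rgg_prob_def using connected_geometric_graph_mono[OF _ r]
    by (intro P.finite_measure_mono geometric_graph_event[OF \<mu>]) blast
qed

section \<open>The threshold for a density bounded away from zero\<close>

text \<open>The constant \<open>m\<close> plays the role of the essential infimum of a density on \<open>[a, b]\<close>, expressed
  through the measures of intervals.  The last assumption says that densities arbitrarily close to
  \<open>m\<close> prevail on some subinterval; this subinterval is kept away from \<open>a\<close> and \<open>b\<close> to leave room for
  points on both sides of a gap.\<close>

locale min_density_distribution =
  fixes \<mu> :: "real measure" and a b m :: real
  assumes prob_space_\<mu>: "prob_space \<mu>"
    and sets_\<mu>: "sets \<mu> = sets borel"
    and m_pos: "0 < m"
    and ab: "a < b"
    and full: "measure \<mu> {a..b} = 1"
    and lower: "\<And>x y. a \<le> x \<Longrightarrow> x \<le> y \<Longrightarrow> y \<le> b \<Longrightarrow> m * (y - x) \<le> measure \<mu> {x<..y}"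
    and upper: "\<And>c. m < c \<Longrightarrow> \<exists>u v. a < u \<and> u < v \<and> v < b \<and>
      (\<forall>x y. u \<le> x \<longrightarrow> x \<le> y \<longrightarrow> y \<le> v \<longrightarrow> measure \<mu> {x<..y} \<le> c * (y - x))"
begin

lemma prob_avoiding_interval_le:
  assumes "a \<le> x" "x \<le> y" "y \<le> b"
  shows "measure (random_points \<mu> n) (avoiding \<mu> n {x<..y}) \<le> (1 - m * (y - x)) ^ n"
proof -
  interpret prob_space \<mu> by (rule prob_space_\<mu>)
  have "measure (random_points \<mu> n) (avoiding \<mu> n {x<..y}) = (1 - measure \<mu> {x<..y}) ^ n"
    by (intro prob_avoiding prob_space_\<mu> sets_\<mu>) simp
  also have "\<dots> \<le> (1 - m * (y - x)) ^ n"
    using lower[OF assms] by (intro power_mono) auto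
  finally show ?thesis .
qed

text \<open>The grid of windows of length \<open>w\<close> with step \<open>h\<close> is so fine that any gap longer than \<open>w + h\<close>
  contains a whole window, which replaces conditioning on the positions of points by a union bound
  over deterministic intervals.\<close>

lemma prob_disconnected_le:
  assumes n: "0 < n" and w: "0 < w" "m * w \<le> 1" and h: "0 < h"
  shows "1 - rgg_prob \<mu> connected_graph n (w + h) \<le> ((b - a) / h + 1) * (1 - m * w) ^ n"
proof -
  let ?P = "random_points \<mu> n"
  interpret P: prob_space ?P by (intro prob_space_random_points prob_space_\<mu>)
  define g where "g k = a + real k * h" for k :: nat
  define K where "K = {k. g k + w \<le> b}"
  let ?A = "\<lambda>k. avoiding \<mu> n {g k<..g k + w}"
  let ?F = "{x \<in> space ?P. \<forall>j<n. x j \<in> {a..b}}"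
  let ?D = "{x \<in> space ?P. \<not> connected_graph (geometric_graph n (w + h) x)}"
  have D: "?D \<in> sets ?P"
    by (rule geometric_graph_event[OF sets_\<mu>, where \<Theta> = "\<lambda>G. \<not> connected_graph G"])
  have ivl: "{a..b} \<in> sets \<mu>" by (simp add: sets_\<mu>)
  have F: "?F \<in> sets ?P" by (rule random_points_all_in_event[OF ivl])
  have F_full: "P.prob ?F = 1"
    unfolding prob_random_points_all_in[OF prob_space_\<mu> ivl] full by simp
  have A: "?A k \<in> sets ?P" for k
    by (intro avoiding_event prob_space_\<mu> sets_\<mu>) simp
  have K_le: "K \<subseteq> {..nat \<lfloor>(b - a) / h\<rfloor>}"
  proof
    fix k assume "k \<in> K"
    then have "real k \<le> (b - a) / h" using h w by (auto simp: K_def g_def field_simps)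
    then show "k \<in> {..nat \<lfloor>(b - a) / h\<rfloor>}" by (simp add: le_nat_floor)
  qed
  then have finK: "finite K" by (rule finite_subset) simp
  have "card K \<le> nat \<lfloor>(b - a) / h\<rfloor> + 1"
    using card_mono[OF _ K_le] by simp
  moreover have "real (nat \<lfloor>(b - a) / h\<rfloor>) \<le> (b - a) / h"
    using h ab by (intro of_nat_floor) simp
  ultimately have cardK: "real (card K) \<le> (b - a) / h + 1" by linarith
  have cover: "?D \<inter> ?F \<subseteq> (\<Union>k\<in>K. ?A k)"
  proof
    fix x assume x: "x \<in> ?D \<inter> ?F"
    then have nc: "\<not> connected_graph (geometric_graph n (w + h) x)" by simp
    obtain i j where ij: "i < n" "j < n" "x i + (w + h) < x j"
      and gap: "\<And>k. k < n \<Longrightarrow> x k \<le> x i \<or> x j \<le> x k"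
      using not_connected_obtains_gap[OF n _ nc] w h by (metis add_nonneg_nonneg less_imp_le)
    \<comment> \<open>The first grid point at or after \<open>x i\<close> comes less than \<open>h\<close> later.\<close>
    define k where "k = nat \<lceil>(x i - a) / h\<rceil>"
    have ax: "a \<le> x i" "x j \<le> b" using x ij by auto
    then have "(x i - a) / h \<le> real k" "real k < (x i - a) / h + 1"
      unfolding k_def using h by (auto simp: real_nat_ceiling_ge) linarith+
    then have k: "x i \<le> g k" "g k < x i + h" using h by (auto simp: g_def field_simps)
    have "k \<in> K" using k ij ax by (simp add: K_def)
    moreover have "x \<in> ?A k"
      using x gap k ij unfolding avoiding_def by fastforce
    ultimately show "x \<in> (\<Union>k\<in>K. ?A k)" by blast
  qed
  have "1 - rgg_prob \<mu> connected_graph n (w + h) = P.prob ?D"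
    unfolding rgg_prob_def
    using P.prob_neg[OF geometric_graph_event[OF sets_\<mu>, of n connected_graph "w + h"]] by simp
  \<comment> \<open>Points outside \<open>[a, b]\<close> could bound a gap that no window detects, but almost surely
    there are none.\<close>
  also have "\<dots> = P.prob (?D \<inter> ?F)"
  proof (rule P.finite_measure_eq_AE[OF _ D sets.Int[OF D F]])
    show "AE x in ?P. x \<in> ?D \<longleftrightarrow> x \<in> ?D \<inter> ?F"
      using P.AE_prob_1[OF F_full] by eventually_elim blast
  qed
  also have "\<dots> \<le> P.prob (\<Union>k\<in>K. ?A k)"
    using cover A finK by (intro P.finite_measure_mono) auto
  also have "\<dots> \<le> (\<Sum>k\<in>K. P.prob (?A k))"
    using A finK by (intro P.finite_measure_subadditive_finite) auto
  also have "\<dots> \<le> (\<Sum>k\<in>K. (1 - m * w) ^ n)"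
  proof (rule sum_mono)
    fix k assume "k \<in> K"
    then show "P.prob (?A k) \<le> (1 - m * w) ^ n"
      using prob_avoiding_interval_le[of "g k" "g k + w" n] w h by (simp add: K_def g_def)
  qed
  also have "\<dots> \<le> ((b - a) / h + 1) * (1 - m * w) ^ n"
    using cardK w by (simp add: mult_right_mono)
  finally show ?thesis .
qed

text \<open>The first summand bounds the probability that each of at least \<open>(v - u) / r - 1\<close> disjoint
  intervals of length \<open>r\<close> within \<open>(u, v]\<close> receives a point; the other two bound the probability
  that the region \<open>(a, u]\<close> or \<open>(v, b]\<close> receives none.\<close>

lemma prob_connected_le:
  assumes uv: "a < u" "u < v" "v < b"
    and c: "\<And>x y. u \<le> x \<Longrightarrow> x \<le> y \<Longrightarrow> y \<le> v \<Longrightarrow> measure \<mu> {x<..y} \<le> c * (y - x)"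
    and r: "0 < r" "r < v - u" "c * r < 1"
  shows "rgg_prob \<mu> connected_graph n r \<le>
    1 / (((v - u) / r - 1) * (1 - c * r) ^ n) + (1 - m * (u - a)) ^ n + (1 - m * (b - v)) ^ n"
proof -
  let ?P = "random_points \<mu> n"
  interpret M: prob_space \<mu> by (rule prob_space_\<mu>)
  interpret P: prob_space ?P by (intro prob_space_random_points prob_space_\<mu>)
  define N where "N = nat \<lfloor>(v - u) / r\<rfloor>"
  define g where "g k = u + real k * r" for k :: nat
  define I where "I k = {g k<..g k + r}" for k
  let ?A = "\<lambda>k. avoiding \<mu> n (I k)"
  let ?C = "{x \<in> space ?P. connected_graph (geometric_graph n r x)}"
  let ?H = "{x \<in> space ?P. \<forall>k\<in>{..<N}. x \<notin> ?A k}"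
  have N: "(v - u) / r - 1 < real N" "real N \<le> (v - u) / r"
    unfolding N_def using r uv by (auto intro!: of_nat_floor)
  have g: "u \<le> g k" "g k + r \<le> v" if "k < N" for k
  proof -
    have "real k + 1 \<le> (v - u) / r" using that N by linarith
    then show "u \<le> g k" "g k + r \<le> v" using r by (auto simp: g_def field_simps)
  qed
  have A: "avoiding \<mu> n {x<..y} \<in> sets ?P" for x y
    by (intro avoiding_event prob_space_\<mu> sets_\<mu>) simp
  have pA: "P.prob (avoiding \<mu> n J) = (1 - M.prob J) ^ n" if "J \<in> sets borel" for J
    by (intro prob_avoiding prob_space_\<mu> sets_\<mu> that)
  have I: "I k \<in> sets \<mu>" for k by (simp add: I_def sets_\<mu>)
  have I_less: "I k \<inter> I l = {}" if "k < l" for k l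
  proof -
    have "real k + 1 \<le> real l" using that by linarith
    then have "(real k + 1) * r \<le> real l * r" using r by (intro mult_right_mono) auto
    then show ?thesis by (auto simp: I_def g_def algebra_simps)
  qed
  have disj: "I k \<inter> I l = {}" if "k \<noteq> l" for k l
    using that I_less[of k l] I_less[of l k] by (cases "k < l") auto
  have H: "?H \<in> sets ?P"
  proof -
    have "?H = space ?P - (\<Union>k\<in>{..<N}. ?A k)" by auto
    then show ?thesis using A by (auto simp: I_def)
  qed
  have neg: "P.prob (?A k \<inter> ?A l) \<le> P.prob (?A k) * P.prob (?A l)" if "k \<noteq> l" for k l
  proof -
    have "?A k \<inter> ?A l = avoiding \<mu> n (I k \<union> I l)" by (auto simp: avoiding_def)
    then have "P.prob (?A k \<inter> ?A l) = (1 - M.prob (I k \<union> I l)) ^ n"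
      using I by (simp add: pA sets_\<mu>)
    \<comment> \<open>Negative correlation: \<open>1 - (p + q) \<le> (1 - p) * (1 - q)\<close>.\<close>
    also have "\<dots> \<le> ((1 - M.prob (I k)) * (1 - M.prob (I l))) ^ n"
    proof (rule power_mono)
      have "M.prob (I k \<union> I l) = M.prob (I k) + M.prob (I l)"
        using I disj[OF that] by (intro M.finite_measure_Union) auto
      then show "1 - M.prob (I k \<union> I l) \<le> (1 - M.prob (I k)) * (1 - M.prob (I l))"
        by (simp add: algebra_simps)
    qed simp
    finally show ?thesis using I by (simp add: pA sets_\<mu> power_mult_distrib)
  qed
  have "real N * (1 - c * r) ^ n = (\<Sum>k<N. (1 - c * r) ^ n)" by simp
  also have "\<dots> \<le> (\<Sum>k<N. P.prob (?A k))"
  proof (rule sum_mono)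
    fix k assume "k \<in> {..<N}"
    then have "M.prob (I k) \<le> c * r" using c[of "g k" "g k + r"] g[of k] r by (simp add: I_def)
    then show "(1 - c * r) ^ n \<le> P.prob (?A k)"
      using r I by (simp add: pA sets_\<mu> power_mono)
  qed
  finally have S_ge: "real N * (1 - c * r) ^ n \<le> (\<Sum>k<N. P.prob (?A k))" .
  have N_pos: "0 < ((v - u) / r - 1) * (1 - c * r) ^ n"
    using r by (intro mult_pos_pos) auto
  moreover have "((v - u) / r - 1) * (1 - c * r) ^ n \<le> real N * (1 - c * r) ^ n"
    using N r by (intro mult_right_mono) auto
  ultimately have S: "((v - u) / r - 1) * (1 - c * r) ^ n \<le> (\<Sum>k<N. P.prob (?A k))"
    "0 < (\<Sum>k<N. P.prob (?A k))"
    using S_ge by linarith+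
  have "P.prob ?H \<le> 1 / (\<Sum>k<N. P.prob (?A k))"
    using A neg S by (intro P.prob_no_event_le_inverse_sum) (auto simp: I_def)
  also have "\<dots> \<le> 1 / (((v - u) / r - 1) * (1 - c * r) ^ n)"
    using S N_pos by (intro divide_left_mono) auto
  finally have hit: "P.prob ?H \<le> 1 / (((v - u) / r - 1) * (1 - c * r) ^ n)" .
  have "?C \<subseteq> ?H \<union> avoiding \<mu> n {a<..u} \<union> avoiding \<mu> n {v<..b}"
  proof (rule subsetI, rule ccontr)
    fix x assume x: "x \<in> ?C" and no: "x \<notin> ?H \<union> avoiding \<mu> n {a<..u} \<union> avoiding \<mu> n {v<..b}"
    then obtain i j k where "i < n" "x i \<in> {a<..u}" "j < n" "x j \<in> {v<..b}" "k < N" "x \<in> ?A k"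
      unfolding avoiding_def by blast
    then have ij: "i < n" "x i \<le> u" "j < n" "v < x j" and k: "k < N" "x \<in> ?A k" by auto
    have "x j \<le> g k"
    proof (rule connected_geometric_graph_not_split[where n = n and r = r and u = i])
      show "connected_graph (geometric_graph n r x)" using x by simp
      show "x l \<le> g k \<or> g k + r < x l" if "l < n" for l
        using k that by (auto simp: avoiding_def I_def not_le)
      show "x i \<le> g k" using ij g[OF k(1)] by simp
    qed (use ij in auto)
    then show False using g[OF k(1)] ij r by simp
  qed
  then have "P.prob ?C \<le> P.prob (?H \<union> avoiding \<mu> n {a<..u} \<union> avoiding \<mu> n {v<..b})"
    using A H by (intro P.finite_measure_mono) auto
  also have "\<dots> \<le> P.prob ?H + P.prob (avoiding \<mu> n {a<..u}) + P.prob (avoiding \<mu> n {v<..b})"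
    using A H by (intro order_trans[OF measure_Un_le] add_right_mono measure_Un_le) auto
  also have "\<dots> \<le> 1 / (((v - u) / r - 1) * (1 - c * r) ^ n) + (1 - m * (u - a)) ^ n + (1 - m * (b - v)) ^ n"
    using hit prob_avoiding_interval_le[of a u n] prob_avoiding_interval_le[of v b n] uv
    by (intro add_mono) auto
  finally show ?thesis by (simp add: rgg_prob_def)
qed

text \<open>Above the threshold the window length is the threshold itself and the grid step is the excess
  \<open>\<epsilon> \<delta>\<close>: the bound is of order \<open>n / ln n\<close> times \<open>(1 - ln n / n) ^ n\<close>, hence \<open>O (1 / ln n)\<close>.
  Below it, about \<open>n / ln n\<close> intervals are each empty with probability about \<open>n powr - q\<close> for
  some \<open>q < 1\<close>.\<close>

lemma connectivity_strong_threshold: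
  "strong_threshold \<mu> connected_graph (\<lambda>n. ln (real n) / (m * real n))"
proof -
  let ?\<delta> = "\<lambda>n. ln (real n) / (m * real n)"
  have pos: "\<forall>\<^sub>F n in sequentially. 0 < ?\<delta> n"
    using m_pos by real_asymp
  have above: "(\<lambda>n. rgg_prob \<mu> connected_graph n ((1 + \<epsilon>) * ?\<delta> n)) \<longlonglongrightarrow> 1" if \<epsilon>: "\<epsilon> > 0" for \<epsilon>
  proof -
    have lim: "(\<lambda>n. ((b - a) / (\<epsilon> * ?\<delta> n) + 1) * (1 - m * ?\<delta> n) ^ n) \<longlonglongrightarrow> 0"
      using m_pos \<epsilon> ab by real_asymp
    have "\<forall>\<^sub>F n in sequentially. m * ?\<delta> n \<le> 1"
      using m_pos by real_asymp
    with pos have le: "\<forall>\<^sub>F n in sequentially. 1 - rgg_prob \<mu> connected_graph n ((1 + \<epsilon>) * ?\<delta> n) \<le>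
        ((b - a) / (\<epsilon> * ?\<delta> n) + 1) * (1 - m * ?\<delta> n) ^ n"
      using eventually_gt_at_top[of 0]
    proof eventually_elim
      case (elim n)
      then show ?case
        using prob_disconnected_le[of n "?\<delta> n" "\<epsilon> * ?\<delta> n"] \<epsilon> by (simp only: distrib_right mult_1_left zero_less_mult_iff) blast
    qed
    have "(\<lambda>n. 1 - rgg_prob \<mu> connected_graph n ((1 + \<epsilon>) * ?\<delta> n)) \<longlonglongrightarrow> 0"
    proof (rule tendsto_sandwich[OF _ le tendsto_const lim])
      show "\<forall>\<^sub>F n in sequentially. 0 \<le> 1 - rgg_prob \<mu> connected_graph n ((1 + \<epsilon>) * ?\<delta> n)"
        using prob_space.prob_le_1[OF prob_space_random_points[OF prob_space_\<mu>]]
        by (simp add: rgg_prob_def)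
    qed
    from tendsto_diff[OF tendsto_const[of 1] this] show ?thesis by simp
  qed
  have below: "(\<lambda>n. rgg_prob \<mu> connected_graph n ((1 - \<epsilon>) * ?\<delta> n)) \<longlonglongrightarrow> 0"
    if \<epsilon>: "\<epsilon> > 0" "\<epsilon> < 1" for \<epsilon>
  proof -
    \<comment> \<open>The density bound \<open>c\<close> must exceed \<open>m\<close>, yet satisfy \<open>c * r = q * ln n / n\<close> with \<open>q < 1\<close>;
      any \<open>q\<close> strictly between \<open>1 - \<epsilon>\<close> and \<open>1\<close> allows this.\<close>
    define q where "q = 1 - \<epsilon> / 2"
    define c where "c = m * q / (1 - \<epsilon>)"
    have q: "0 < q" "q < 1" using \<epsilon> by (auto simp: q_def)
    have "m < c" using \<epsilon> m_pos by (simp add: c_def q_def field_simps)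
    then obtain u v where uv: "a < u" "u < v" "v < b"
      and c: "\<And>x y. u \<le> x \<Longrightarrow> x \<le> y \<Longrightarrow> y \<le> v \<Longrightarrow> measure \<mu> {x<..y} \<le> c * (y - x)"
      using upper by blast
    let ?r = "\<lambda>n. (1 - \<epsilon>) * ?\<delta> n"
    \<comment> \<open>An atomic name for \<open>1 - \<epsilon>\<close> lets the asymptotic expansions below read off its sign.\<close>
    define \<eta> where "\<eta> = 1 - \<epsilon>"
    have \<eta>: "0 < \<eta>" using \<epsilon> by (simp add: \<eta>_def)
    have cr: "c * ?r n = q * (ln (real n) / real n)" for n
      using m_pos \<epsilon> by (simp add: c_def)
    have "(\<lambda>n. 1 / (((v - u) / ?r n - 1) * (1 - c * ?r n) ^ n)) \<longlonglongrightarrow> 0"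
      unfolding cr unfolding \<eta>_def[symmetric] using uv m_pos \<eta> q by real_asymp
    moreover have "(\<lambda>n. (1 - m * (y - x)) ^ n) \<longlonglongrightarrow> 0" if "a \<le> x" "x < y" "y \<le> b" for x y
    proof (rule LIMSEQ_realpow_zero)
      have "m * (y - x) \<le> 1"
        using lower[of x y] that prob_space.prob_le_1[OF prob_space_\<mu>, of "{x<..y}"] by linarith
      then show "0 \<le> 1 - m * (y - x)" by simp
      show "1 - m * (y - x) < 1" using m_pos that by simp
    qed
    ultimately have lim: "(\<lambda>n. 1 / (((v - u) / ?r n - 1) * (1 - c * ?r n) ^ n) +
        (1 - m * (u - a)) ^ n + (1 - m * (b - v)) ^ n) \<longlonglongrightarrow> 0"
      using uv by (intro tendsto_add_zero) auto
    have "\<forall>\<^sub>F n in sequentially. ?r n < v - u"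
      unfolding \<eta>_def[symmetric] using uv m_pos \<eta> by real_asymp
    moreover have "\<forall>\<^sub>F n in sequentially. c * ?r n < 1"
      unfolding cr using q by real_asymp
    ultimately have "\<forall>\<^sub>F n in sequentially. rgg_prob \<mu> connected_graph n (?r n) \<le>
        1 / (((v - u) / ?r n - 1) * (1 - c * ?r n) ^ n) +
        (1 - m * (u - a)) ^ n + (1 - m * (b - v)) ^ n"
      using pos
    proof eventually_elim
      case (elim n)
      then show ?case using \<epsilon> by (intro prob_connected_le uv c) (auto simp del: times_divide_eq_right)
    qed
    then show ?thesis
      by (intro tendsto_sandwich[OF _ _ tendsto_const lim]) (auto simp: rgg_prob_def)
  qed
  show ?thesis
    unfolding strong_threshold_def cutoff_fun_def using pos above below by blast
qed

end

section \<open>The truncated exponential distribution\<close>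

lemma measure_trunc_exp_interval:
  assumes "rate > 0" "T > 0" "0 \<le> x" "x \<le> y" "y \<le> T"
  shows "measure (trunc_exp rate T) {x<..y} =
    (exp (- rate * x) - exp (- rate * y)) / (1 - exp (- rate * T))"
    and "measure (trunc_exp rate T) {x..y} =
    (exp (- rate * x) - exp (- rate * y)) / (1 - exp (- rate * T))"
proof -
  let ?p = "1 - exp (- rate * T)"
  have p: "?p > 0" using assms by simp
  have E: "emeasure (trunc_exp rate T) {x..y} = 
     ennreal ((exp (- rate * x) - exp (- rate * y)) / ?p)"
  proof -
    have "emeasure (trunc_exp rate T) {x..y} =
      (\<integral>\<^sup>+z. ennreal (rate * exp (- rate * z) / ?p) * indicator {x..y} z \<partial>lborel)"
      unfolding trunc_exp_def using assms
      by (subst emeasure_density)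
        (auto simp: trunc_exp_density_def indicator_def intro!: nn_integral_cong)
    also have "\<dots> = ennreal (- exp (- rate * y) / ?p - (- exp (- rate * x) / ?p))"
      using assms p
      by (intro nn_integral_FTC_Icc) (auto intro!: derivative_eq_intros)
    finally show ?thesis by (simp add: diff_divide_distrib)
  qed
  have F: "emeasure (trunc_exp rate T) {x<..y} = emeasure (trunc_exp rate T) {x..y}"
    unfolding trunc_exp_def
    by (subst (1 2) emeasure_density)
      (auto simp: trunc_exp_density_def indicator_def
        intro!: nn_integral_cong_AE eventually_mono[OF AE_lborel_singleton[of x]])
  have nn: "0 \<le> (exp (- rate * x) - exp (- rate * y)) / ?p"
    using assms p by simp
  show "measure (trunc_exp rate T) {x<..y} = (exp (- rate * x) - exp (- rate * y)) / ?p"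
    "measure (trunc_exp rate T) {x..y} = (exp (- rate * x) - exp (- rate * y)) / ?p"
    unfolding measure_def F E using nn by auto
qed

text \<open>The density decreases on \<open>[0, T]\<close>, so its minimum is the value at \<open>T\<close>; by continuity it is
  nearly attained on an interval \<open>(u, (u + T) / 2]\<close> with \<open>u\<close> slightly less than \<open>T\<close>.  The
  interval bounds come from \<open>1 + z \<le> exp z\<close> applied to \<open>z = \<plusminus> rate * (y - x)\<close>.\<close>

lemma trunc_exp_min_density_distribution:
  assumes rate: "rate > 0" and T: "T > 0"
  shows "min_density_distribution (trunc_exp rate T) 0 T
    (rate * exp (- rate * T) / (1 - exp (- rate * T)))"
proof -
  let ?p = "1 - exp (- rate * T)"
  have p: "?p > 0" using assms by simp
  have lo: "rate * exp (- rate * T) / ?p * (y - x) \<le> measure (trunc_exp rate T) {x<..y}"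
    if "0 \<le> x" "x \<le> y" "y \<le> T" for x y
  proof -
    have "exp (- rate * T) * (rate * (y - x)) \<le> exp (- rate * y) * (exp (rate * (y - x)) - 1)"
      using that rate exp_ge_add_one_self[of "rate * (y - x)"]
      by (intro mult_mono) (auto simp del: exp_ge_add_one_self simp: le_diff_eq add.commute)
    also have "\<dots> = exp (- rate * x) - exp (- rate * y)"
      by (simp add: right_diff_distrib exp_add[symmetric] algebra_simps)
    finally show ?thesis
      using p that assms by (simp add: measure_trunc_exp_interval divide_right_mono mult_ac)
  qed
  have up: "\<exists>u v. 0 < u \<and> u < v \<and> v < T \<and> (\<forall>x y. u \<le> x \<longrightarrow> x \<le> y \<longrightarrow> y \<le> v \<longrightarrow>
      measure (trunc_exp rate T) {x<..y} \<le> c * (y - x))"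
    if c: "rate * exp (- rate * T) / ?p < c" for c
  proof -
    have "((\<lambda>u. rate * exp (- rate * u) / ?p) \<longlongrightarrow> rate * exp (- rate * T) / ?p) (at_left T)"
      using p by (intro tendsto_intros) auto
    then have "\<forall>\<^sub>F u in at_left T. rate * exp (- rate * u) / ?p < c"
      using c by (rule order_tendstoD)
    moreover have "\<forall>\<^sub>F u in at_left T. 0 < u \<and> u < T"
      using eventually_at_left_real[OF T] by eventually_elim auto
    ultimately have "\<forall>\<^sub>F u in at_left T. (0 < u \<and> u < T) \<and> rate * exp (- rate * u) / ?p < c"
      by eventually_elim simp
    then obtain u where u: "0 < u" "u < T" "rate * exp (- rate * u) / ?p < c"
      using eventually_happens[of _ "at_left T"] by auto
    have "measure (trunc_exp rate T) {x<..y} \<le> c * (y - x)"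
      if "u \<le> x" "x \<le> y" "y \<le> (u + T) / 2" for x y
    proof -
      have "exp (- rate * x) - exp (- rate * y) = exp (- rate * x) * (1 - exp (- (rate * (y - x))))"
        by (simp add: right_diff_distrib exp_add[symmetric] algebra_simps)
      also have "\<dots> \<le> exp (- rate * u) * (rate * (y - x))"
        using that rate exp_ge_add_one_self[of "- (rate * (y - x))"] by (intro mult_mono) auto
      finally have "measure (trunc_exp rate T) {x<..y} \<le> rate * exp (- rate * u) / ?p * (y - x)"
        using p that assms u by (simp add: measure_trunc_exp_interval divide_right_mono mult_ac)
      also have "\<dots> \<le> c * (y - x)"
        using u that by (intro mult_right_mono) auto
      finally show ?thesis .
    qed
    then show ?thesis
      using u by (intro exI[of _ u] exI[of _ "(u + T) / 2"]) auto
  qed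
  show ?thesis
  proof (intro min_density_distribution.intro prob_space_trunc_exp assms)
    show "sets (trunc_exp rate T) = sets borel" by (simp add: trunc_exp_def)
    show "0 < rate * exp (- rate * T) / ?p" using p rate by simp
    show "measure (trunc_exp rate T) {0..T} = 1"
      using measure_trunc_exp_interval(2)[OF assms, of 0 T] T p rate by simp
  qed (use lo up in auto)
qed

theorem theorem9:
  fixes rate T p :: real and \<delta> :: "nat \<Rightarrow> real"
  assumes "rate > 0" and "T > 0"
    and "p = 1 - exp (- rate * T)"
    and "\<And>n. \<delta> n = p / (rate * (1 - p)) * (ln (real n) / real n)"
  shows "strong_threshold (trunc_exp rate T) connected_graph \<delta> \<and>
         weak_threshold (trunc_exp rate T) connected_graph \<delta>"
proof -
  interpret min_density_distribution "trunc_exp rate T" 0 T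
    "rate * exp (- rate * T) / (1 - exp (- rate * T))"
    by (intro trunc_exp_min_density_distribution assms)
  have "\<delta> = (\<lambda>n. ln (real n) / (rate * exp (- rate * T) / (1 - exp (- rate * T)) * real n))"
    by (rule ext) (simp add: assms)
  then have strong: "strong_threshold (trunc_exp rate T) connected_graph \<delta>"
    using connectivity_strong_threshold by simp
  have "weak_threshold (trunc_exp rate T) connected_graph \<delta>"
    by (rule strong_threshold_imp_weak_threshold[OF prob_space_\<mu> _ strong])
       (rule rgg_prob_connected_mono[OF prob_space_\<mu> sets_\<mu>])
  with strong show ?thesis by simp
qed

end
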